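(* Let $N\ge 1$ be an integer, let $x\in[0,1]$, and let $\sigma$ be a permutation of $\{1,\dots,N\}$, either deterministic or random. Let $X_1,\dots,X_N$ be the dither computing representation of $x$ with permutation $\sigma$ (defined in the context), and let $X_s=\frac1N\sum_{i=1}^N X_i$. Then $E(X_s)=x$ (that is, the bias $E(X_s)-x$ is $0$) and $\mathrm{Var}(X_s)\le \frac{2}{N^2}$. Consequently, if $X$ is a random variable with values in $[0,1]$ and each sample $x$ of $X$ is represented in this way, the expected mean squared error satisfies $L=O\left(\frac{1}{N^2}\right)$ as $N\to\infty$.
   Context: Dither computing representation of $x\in[0,1]$ with $N$ pulses and permutation $\sigma$ of $\{1,\dots,N\}$: $X_1,\dots,X_N$ are independent Bernoulli ($\{0,1\}$-valued) random variables (if $\sigma$ is random, this and the probabilities below are understood conditionally on $\sigma$) with success probabilities as follows. If $x\in[0,\frac12]$: let $n=\lfloor Nx\rfloor$, $r=x-\frac nN$, $\delta=\frac{Nr}{N-n}$. Then $P(X_{\sigma(i)}=1)=1$ for $1\le i\le n$ and $P(X_{\sigma(i)}=1)=\delta$ for $n+1\le i\le N$. If $x\in(\frac12,1]$: let $n=\lceil Nx\rceil$, $r=\frac nN-x$, $\delta=\frac{rN}{n}$. Then $P(X_{\sigma(i)}=1)=1-\delta$ for $1\le i\le n$ and $P(X_{\sigma(i)}=1)=0$ for $n+1\le i\le N$. The expected mean squared error (EMSE) is $L=E_X(L_x)$, where $L_x=E\big((X_s-x)^2\mid X=x\big)$ and $E_X$ is the expectation over the distribution of $X$. *)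

theory Defs
  imports "HOL-Probability.Probability" "HOL-Library.Landau_Symbols"
    "HOL-Combinatorics.Permutations"
begin

text \<open>Success probability of the pulse in position \<open>i\<close> before permuting,
  that is, of the pulse with index \<open>\<sigma> i\<close>.\<close>

definition dither_prob :: "nat \<Rightarrow> real \<Rightarrow> nat \<Rightarrow> real" where
  "dither_prob N x i =
    (if x \<le> 1/2 then
       let n = nat \<lfloor>real N * x\<rfloor>;
           r = x - real n / real N;
           \<delta> = real N * r / (real N - real n)
       in if i \<le> n then 1 else \<delta>
     else
       let n = nat \<lceil>real N * x\<rceil>;
           r = real n / real N - x;
           \<delta> = r * real N / real n
       in if i \<le> n then 1 - \<delta> else 0)"

definition dither_fixed ::
  "'a measure \<Rightarrow> nat \<Rightarrow> real \<Rightarrow> (nat \<Rightarrow> nat) \<Rightarrow> (nat \<Rightarrow> 'a \<Rightarrow> real) \<Rightarrow> bool" where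
  "dither_fixed M N x \<sigma> Y \<longleftrightarrow>
     prob_space M \<and>
     \<sigma> permutes {1..N} \<and>
     prob_space.indep_vars M (\<lambda>_. borel) Y {1..N} \<and>
     (\<forall>i\<in>{1..N}. \<forall>\<omega>\<in>space M. Y i \<omega> \<in> {0, 1}) \<and>
     (\<forall>i\<in>{1..N}. measure M {\<omega> \<in> space M. Y (\<sigma> i) \<omega> = 1} = dither_prob N x i)"

text \<open>For a random permutation \<open>S\<close> the requirements are imposed conditionally on \<open>S\<close>.
  For an event \<open>A\<close> of positive probability, \<^term>\<open>uniform_measure M A\<close> is the
  conditional probability measure given \<open>A\<close>.\<close>

definition dither_random ::
  "'a measure \<Rightarrow> nat \<Rightarrow> real \<Rightarrow> ('a \<Rightarrow> nat \<Rightarrow> nat) \<Rightarrow> (nat \<Rightarrow> 'a \<Rightarrow> real) \<Rightarrow> bool" where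
  "dither_random M N x S Y \<longleftrightarrow>
     prob_space M \<and>
     S \<in> measurable M (count_space {\<sigma>. \<sigma> permutes {1..N}}) \<and>
     (\<forall>\<sigma>. measure M {\<omega> \<in> space M. S \<omega> = \<sigma>} > 0 \<longrightarrow>
        dither_fixed (uniform_measure M {\<omega> \<in> space M. S \<omega> = \<sigma>}) N x \<sigma> Y)"

definition pulse_mean :: "nat \<Rightarrow> (nat \<Rightarrow> 'a \<Rightarrow> real) \<Rightarrow> 'a \<Rightarrow> real" where
  "pulse_mean N Y \<omega> = (\<Sum>i=1..N. Y i \<omega>) / real N"

text \<open>\<open>K x\<close> is a regular version of the conditional probability given \<open>X = x\<close>. It gives
  meaning to conditioning on \<open>X = x\<close> when this event has probability zero.\<close>

definition regular_cond_prob ::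
  "'a measure \<Rightarrow> ('a \<Rightarrow> real) \<Rightarrow> (real \<Rightarrow> 'a measure) \<Rightarrow> bool" where
  "regular_cond_prob M X K \<longleftrightarrow>
     K \<in> measurable borel (prob_algebra M) \<and>
     (\<forall>A\<in>sets M. \<forall>B\<in>sets borel.
        emeasure M {\<omega> \<in> A. X \<omega> \<in> B} =
          (\<integral>\<^sup>+x\<in>B. emeasure (K x) A \<partial>distr M borel X))"

definition cond_mse ::
  "(real \<Rightarrow> 'a measure) \<Rightarrow> nat \<Rightarrow> (nat \<Rightarrow> 'a \<Rightarrow> real) \<Rightarrow> real \<Rightarrow> real" where
  "cond_mse K N Y x = (\<integral>\<omega>. (pulse_mean N Y \<omega> - x)\<^sup>2 \<partial>K x)"

definition emse ::
  "'a measure \<Rightarrow> ('a \<Rightarrow> real) \<Rightarrow> (real \<Rightarrow> 'a measure) \<Rightarrow> nat \<Rightarrow> (nat \<Rightarrow> 'a \<Rightarrow> real) \<Rightarrow> real"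
where
  "emse M X K N Y = (\<integral>x. cond_mse K N Y x \<partial>distr M borel X)"

end

(* Given the permutation, the pulses are independent Bernoulli variables whose success
   probabilities sum to N x. At most one unit of randomness is spread over the dithered pulses:
   the variances sum to at most N |x - n/N| <= 1, so the pulse mean has variance at most 1/N^2.
   Since the conditional mean is x for every permutation, averaging over a random permutation
   adds no variance between the permutations. *)

theory Submission
  imports Defs
begin

section \<open>Variances of independent sums and moments of Bernoulli variables\<close>

lemma (in prob_space) variance_sum_indep:
  fixes X :: "'i \<Rightarrow> 'a \<Rightarrow> real"
  assumes fin: "finite I" and indep: "indep_vars (\<lambda>_. borel) X I"
    and int: "\<And>i. i \<in> I \<Longrightarrow> integrable M (X i)"
    and int2: "\<And>i. i \<in> I \<Longrightarrow> integrable M (\<lambda>\<omega>. (X i \<omega>)\<^sup>2)"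
  shows "variance (\<lambda>\<omega>. \<Sum>i\<in>I. X i \<omega>) = (\<Sum>i\<in>I. variance (X i))"
proof -
  \<comment> \<open>Centring: for independent variables of mean zero the expectation of
    \<open>Z i * Z j\<close> factors into 0 when \<open>i \<noteq> j\<close>, so only the diagonal
    of the expanded square survives.\<close>
  define Z where "Z i \<omega> = X i \<omega> - expectation (X i)" for i \<omega>
  have indepZ: "indep_vars (\<lambda>_. borel) Z I"
    unfolding Z_def by (rule indep_vars_compose2[OF indep]) simp
  have intZ: "integrable M (Z i)" if "i \<in> I" for i
    unfolding Z_def using int[OF that] by simp
  have EZ: "expectation (Z i) = 0" if "i \<in> I" for i
    unfolding Z_def using int[OF that] by (simp add: prob_space)
  have intZ2: "integrable M (\<lambda>\<omega>. Z i \<omega> * Z i \<omega>)" if "i \<in> I" for i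
    unfolding Z_def power2_eq_square[symmetric] power2_diff
    using int[OF that] int2[OF that] by simp
  have offdiag: "integrable M (\<lambda>\<omega>. Z i \<omega> * Z j \<omega>) \<and> expectation (\<lambda>\<omega>. Z i \<omega> * Z j \<omega>) = 0"
    if ij: "i \<in> I" "j \<in> I" "i \<noteq> j" for i j
  proof -
    have sub: "indep_vars (\<lambda>_. borel) Z {i, j}"
      using indep_vars_subset[OF indepZ] ij by auto
    \<comment> \<open>Independence of families speaks of finite products; since
      \<open>i \<noteq> j\<close>, the product over \<open>{i, j}\<close> is just
      \<open>Z i \<omega> * Z j \<omega>\<close>.\<close>
    have "integrable M (\<lambda>\<omega>. \<Prod>k\<in>{i, j}. Z k \<omega>)"
      by (rule indep_vars_integrable[OF _ sub]) (use ij intZ in auto)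
    moreover have "expectation (\<lambda>\<omega>. \<Prod>k\<in>{i, j}. Z k \<omega>) = (\<Prod>k\<in>{i, j}. expectation (Z k))"
      by (rule indep_vars_lebesgue_integral[OF _ sub]) (use ij intZ in auto)
    ultimately show ?thesis
      using ij EZ by simp
  qed
  have intZZ: "integrable M (\<lambda>\<omega>. Z i \<omega> * Z j \<omega>)" if "i \<in> I" "j \<in> I" for i j
    using offdiag[OF that] intZ2 that by (cases "i = j") auto
  have "variance (\<lambda>\<omega>. \<Sum>i\<in>I. X i \<omega>) = expectation (\<lambda>\<omega>. (\<Sum>i\<in>I. Z i \<omega>)\<^sup>2)"
    using int by (simp add: Z_def sum_subtractf)
  also have "\<dots> = expectation (\<lambda>\<omega>. \<Sum>i\<in>I. \<Sum>j\<in>I. Z i \<omega> * Z j \<omega>)"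
    by (simp add: power2_eq_square sum_product)
  also have "\<dots> = (\<Sum>i\<in>I. \<Sum>j\<in>I. expectation (\<lambda>\<omega>. Z i \<omega> * Z j \<omega>))"
    using intZZ by (simp add: Bochner_Integration.integral_sum Bochner_Integration.integrable_sum)
  also have "\<dots> = (\<Sum>i\<in>I. expectation (\<lambda>\<omega>. Z i \<omega> * Z i \<omega>))"
  proof (rule sum.cong[OF refl])
    fix i assume i: "i \<in> I"
    have "(\<Sum>j\<in>I. expectation (\<lambda>\<omega>. Z i \<omega> * Z j \<omega>))
        = (\<Sum>j\<in>I. if i = j then expectation (\<lambda>\<omega>. Z i \<omega> * Z i \<omega>) else 0)"
      using offdiag i by (intro sum.cong) auto
    then show "(\<Sum>j\<in>I. expectation (\<lambda>\<omega>. Z i \<omega> * Z j \<omega>)) = expectation (\<lambda>\<omega>. Z i \<omega> * Z i \<omega>)"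
      using i fin by simp
  qed
  finally show ?thesis
    by (simp add: Z_def power2_eq_square)
qed

text \<open>A variable with values in {0, 1} is the indicator of the event that it equals 1 and
  coincides with its own square. So its first and second moments are both \<open>p\<close>, and the
  variance is \<open>p - p * p\<close>.\<close>

lemma (in prob_space)
  fixes Y :: "'a \<Rightarrow> real"
  assumes Y [measurable]: "Y \<in> borel_measurable M"
    and Y01: "\<And>\<omega>. \<omega> \<in> space M \<Longrightarrow> Y \<omega> \<in> {0, 1}"
    and p: "prob {\<omega> \<in> space M. Y \<omega> = 1} = p"
  shows integrable_bernoulli: "integrable M Y"
    and integrable_square_bernoulli: "integrable M (\<lambda>\<omega>. (Y \<omega>)\<^sup>2)"
    and expectation_bernoulli: "expectation Y = p"
    and variance_bernoulli: "variance Y = p * (1 - p)"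
proof -
  show int: "integrable M Y"
  proof (rule integrable_const_bound[where B = 1])
    show "AE \<omega> in M. norm (Y \<omega>) \<le> 1"
    proof (rule AE_I2)
      fix \<omega> assume "\<omega> \<in> space M"
      from Y01[OF this] show "norm (Y \<omega>) \<le> 1"
        by auto
    qed
  qed measurable
  have sq: "(Y \<omega>)\<^sup>2 = Y \<omega>" if "\<omega> \<in> space M" for \<omega>
    using Y01[OF that] by auto
  show int2: "integrable M (\<lambda>\<omega>. (Y \<omega>)\<^sup>2)"
    using int sq by (simp cong: Bochner_Integration.integrable_cong)
  have "expectation Y = expectation (indicator {\<omega> \<in> space M. Y \<omega> = 1})"
    using Y01 by (intro Bochner_Integration.integral_cong) (auto simp: indicator_def)
  then show E: "expectation Y = p"
    using p by simp
  have "expectation (\<lambda>\<omega>. (Y \<omega>)\<^sup>2) = p"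
    using sq E by (simp cong: Bochner_Integration.integral_cong)
  then show "variance Y = p * (1 - p)"
    using variance_eq[OF int int2] E by (simp add: power2_eq_square algebra_simps)
qed

section \<open>Sums of the success probabilities and of the Bernoulli variances\<close>

lemma sum_threshold:
  fixes a b :: real
  assumes "n \<le> N"
  shows "(\<Sum>i=1..N. if i \<le> n then a else b) = real n * a + (real N - real n) * b"
proof -
  have "(\<Sum>i=1..N. if i \<le> n then a else b)
      = (\<Sum>i\<in>{1..n}. a) + (\<Sum>i\<in>{n+1..N}. b)"
  proof -
    have "{1..N} \<inter> {i. i \<le> n} = {1..n}" "{1..N} \<inter> - {i. i \<le> n} = {n+1..N}"
      using assms by auto
    then show ?thesis
      by (simp only: sum.If_cases finite_atLeastAtMost)
  qed
  then show ?thesis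
    using assms by (simp add: of_nat_diff)
qed

text \<open>The correction \<open>d\<close> is chosen so that the dithered pulses make up exactly
  the rounding error of \<open>real N * x\<close>. The deterministic pulses have variance 0, and the
  dithered ones contribute at most their number times \<open>d\<close>. This is the rounding error
  \<open>real N * x - real n\<close> or \<open>real n - real N * x\<close>, which is below
  1.\<close>

lemma
  assumes N: "N \<ge> 1" and x: "x \<in> {0..1}"
  shows sum_dither_prob: "(\<Sum>i=1..N. dither_prob N x i) = real N * x"
    and sum_dither_variance_le:
      "(\<Sum>i=1..N. dither_prob N x i * (1 - dither_prob N x i)) \<le> 1"
proof -
  have "(\<Sum>i=1..N. dither_prob N x i) = real N * x \<and>
    (\<Sum>i=1..N. dither_prob N x i * (1 - dither_prob N x i)) \<le> 1"
  proof (cases "x \<le> 1/2")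
    case True
    define n where "n = nat \<lfloor>real N * x\<rfloor>"
    define d where "d = (real N * x - real n) / (real N - real n)"
    have "0 \<le> real N * x"
      using x by simp
    then have n: "real n \<le> real N * x" "real N * x < real n + 1"
      unfolding n_def by linarith+
    \<comment> \<open>The case \<open>x \<le> 1/2\<close> keeps \<open>n\<close> strictly below
      \<open>N\<close>, so the denominator of \<open>d\<close> is nonzero.\<close>
    have "real N * x \<le> real N * (1/2)"
      using True by (intro mult_left_mono) auto
    then have lt: "real n < real N"
      using n N by linarith
    have eq: "dither_prob N x i = (if i \<le> n then 1 else d)" for i
      using True N by (simp add: dither_prob_def Let_def flip: n_def) (simp add: d_def right_diff_distrib)
    \<comment> \<open>Stated for a variable \<open>p\<close> so that \<open>var[OF eq]\<close>
      rewrites each Bernoulli variance into threshold form, ready for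
      \<open>sum_threshold\<close>.\<close>
    have var: "p * (1 - p) = (if i \<le> n then 0 else d * (1 - d))"
      if "p = (if i \<le> n then 1 else d)" for p i
      using that by simp
    have nd: "(real N - real n) * d = real N * x - real n"
      using lt by (simp add: d_def)
    have "(\<Sum>i=1..N. dither_prob N x i) = real N * x"
      using lt nd by (simp add: eq sum_threshold del: One_nat_def)
    moreover have "(\<Sum>i=1..N. dither_prob N x i * (1 - dither_prob N x i))
        = (real N - real n) * (d * (1 - d))"
      using lt by (simp add: var[OF eq] sum_threshold del: One_nat_def)
    \<comment> \<open>Here \<open>d * (1 - d) \<le> d\<close> amounts to
      \<open>d * d \<ge> 0\<close>.\<close>
    moreover have "\<dots> \<le> (real N - real n) * d"
      using lt by (intro mult_left_mono) (auto simp: algebra_simps)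
    ultimately show ?thesis
      using nd n by linarith
  next
    case False
    define n where "n = nat \<lceil>real N * x\<rceil>"
    define d where "d = (real n - real N * x) / real n"
    have "0 < real N * x"
      using False N by simp
    then have n: "real N * x \<le> real n" "real n < real N * x + 1"
      unfolding n_def by linarith+
    have "real N * x \<le> real N"
      using x by (simp add: mult_left_le)
    then have le: "n \<le> N"
      using n by linarith
    \<comment> \<open>Division by \<open>n\<close> is legitimate because \<open>x > 1/2\<close>
      makes the rounded-up count positive.\<close>
    have pos: "real n > 0"
      using \<open>0 < real N * x\<close> n by linarith
    have "(real n / real N - x) * real N = real n - real N * x"
      using N by (simp add: left_diff_distrib)
    then have eq: "dither_prob N x i = (if i \<le> n then 1 - d else 0)" for i
      using False by (simp only: dither_prob_def Let_def if_False d_def flip: n_def)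
    have var: "p * (1 - p) = (if i \<le> n then d * (1 - d) else 0)"
      if "p = (if i \<le> n then 1 - d else 0)" for p i
      using that by simp
    have nd: "real n * d = real n - real N * x"
      using pos by (simp add: d_def)
    have "(\<Sum>i=1..N. dither_prob N x i) = real N * x"
      using le nd by (simp add: eq sum_threshold right_diff_distrib del: One_nat_def)
    moreover have "(\<Sum>i=1..N. dither_prob N x i * (1 - dither_prob N x i))
        = real n * (d * (1 - d))"
      using le by (simp add: var[OF eq] sum_threshold del: One_nat_def)
    moreover have "\<dots> \<le> real n * d"
      by (intro mult_left_mono) (auto simp: algebra_simps)
    ultimately show ?thesis
      using nd n by linarith
  qed
  then show "(\<Sum>i=1..N. dither_prob N x i) = real N * x"
    "(\<Sum>i=1..N. dither_prob N x i * (1 - dither_prob N x i)) \<le> 1"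
    by auto
qed

section \<open>Mean and variance for a fixed permutation\<close>

lemma dither_fixed_pulse_measurable:
  assumes "dither_fixed M N x \<sigma> Y" "i \<in> {1..N}"
  shows "Y i \<in> borel_measurable M"
  using assms by (auto simp: dither_fixed_def prob_space.indep_vars_def)

lemma
  assumes N: "N \<ge> 1" and x: "x \<in> {0..1}" and d: "dither_fixed M N x \<sigma> Y"
  shows expectation_dither_fixed: "prob_space.expectation M (pulse_mean N Y) = x"
    and variance_dither_fixed_le:
      "prob_space.variance M (pulse_mean N Y) \<le> 1 / (real N)\<^sup>2"
proof -
  interpret prob_space M
    using d by (simp add: dither_fixed_def)
  have perm: "\<sigma> permutes {1..N}" and indep: "indep_vars (\<lambda>_. borel) Y {1..N}"
    and Y01: "\<And>i \<omega>. i \<in> {1..N} \<Longrightarrow> \<omega> \<in> space M \<Longrightarrow> Y i \<omega> \<in> {0, 1}"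
    and p: "\<And>i. i \<in> {1..N} \<Longrightarrow> prob {\<omega> \<in> space M. Y (\<sigma> i) \<omega> = 1} = dither_prob N x i"
    using d by (auto simp: dither_fixed_def)
  note meas = dither_fixed_pulse_measurable[OF d]
  have perm_in: "\<sigma> i \<in> {1..N}" if "i \<in> {1..N}" for i
    using permutes_in_image[OF perm] that by blast
  have int: "integrable M (Y i)" and int2: "integrable M (\<lambda>\<omega>. (Y i \<omega>)\<^sup>2)" if "i \<in> {1..N}" for i
    using integrable_bernoulli[OF meas[OF that] Y01[OF that] refl]
      integrable_square_bernoulli[OF meas[OF that] Y01[OF that] refl] by auto
  have E: "expectation (Y (\<sigma> i)) = dither_prob N x i"
    and V: "variance (Y (\<sigma> i)) = dither_prob N x i * (1 - dither_prob N x i)"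
    if "i \<in> {1..N}" for i
    using expectation_bernoulli[OF meas Y01 p[OF that]] variance_bernoulli[OF meas Y01 p[OF that]]
      perm_in[OF that] by auto
  have "expectation (\<lambda>\<omega>. \<Sum>i=1..N. Y i \<omega>) = (\<Sum>i=1..N. expectation (Y i))"
    using int by simp
  \<comment> \<open>The success probabilities are prescribed along \<open>\<sigma>\<close>.
    Reindexing the sum by the permutation makes them applicable without changing its value; the same
    happens for the variances below.\<close>
  also have "\<dots> = (\<Sum>i=1..N. expectation (Y (\<sigma> i)))"
    by (rule sum.permute[OF perm, unfolded o_def])
  also have "\<dots> = real N * x"
    using E sum_dither_prob[OF N x] by simp
  finally have Esum: "expectation (\<lambda>\<omega>. \<Sum>i=1..N. Y i \<omega>) = real N * x" .
  then show Emean: "expectation (pulse_mean N Y) = x"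
    using N by (simp add: pulse_mean_def[abs_def])
  have "variance (\<lambda>\<omega>. \<Sum>i=1..N. Y i \<omega>) = (\<Sum>i=1..N. variance (Y i))"
    by (rule variance_sum_indep[OF _ indep]) (use int int2 in auto)
  also have "\<dots> = (\<Sum>i=1..N. variance (Y (\<sigma> i)))"
    by (rule sum.permute[OF perm, unfolded o_def])
  also have "\<dots> \<le> 1"
    using V sum_dither_variance_le[OF N x] by simp
  finally have Vsum: "expectation (\<lambda>\<omega>. ((\<Sum>i=1..N. Y i \<omega>) - real N * x)\<^sup>2) \<le> 1"
    using Esum by simp
  \<comment> \<open>Passing from the sum to the mean divides the squared deviation by the square of
    \<open>N\<close>, which turns the bound 1 on the variance of the sum into the claimed
    rate.\<close>
  have "(pulse_mean N Y \<omega> - x)\<^sup>2 = ((\<Sum>i=1..N. Y i \<omega>) - real N * x)\<^sup>2 / (real N)\<^sup>2" for \<omega>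
    using N by (simp add: pulse_mean_def power_divide[symmetric] diff_divide_distrib)
  then show "variance (pulse_mean N Y) \<le> 1 / (real N)\<^sup>2"
    using Vsum Emean by (simp add: divide_right_mono)
qed

section \<open>Conditioning on a random variable with finitely many values\<close>

lemma (in prob_space) integral_uniform_measure:
  fixes f :: "'a \<Rightarrow> real"
  assumes f: "f \<in> borel_measurable M" and A: "A \<in> events" "prob A > 0"
  shows "(\<integral>\<omega>. f \<omega> \<partial>uniform_measure M A) = (\<integral>\<omega>. indicator A \<omega> * f \<omega> \<partial>M) / prob A"
proof -
  \<comment> \<open>The density is rewritten as a real function coerced to \<open>ennreal\<close>,
    the form in which \<open>integral_density\<close> evaluates Bochner integrals.\<close>
  have "uniform_measure M A = density M (\<lambda>\<omega>. ennreal (indicator A \<omega> / prob A))"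
    unfolding uniform_measure_def using A
    by (intro arg_cong[where f = "density M"] ext)
      (auto simp: emeasure_eq_measure indicator_def divide_ennreal[symmetric])
  then have "(\<integral>\<omega>. f \<omega> \<partial>uniform_measure M A) = (\<integral>\<omega>. (indicator A \<omega> / prob A) *\<^sub>R f \<omega> \<partial>M)"
    using f A by (simp add: integral_density)
  then show ?thesis
    by simp
qed

text \<open>The law of total expectation: the fibres of \<open>S\<close> partition the space, so
  \<open>f\<close> splits into its restrictions to them. A fibre of probability 0 contributes
  nothing on either side, whatever value the integral over its \<open>uniform_measure\<close>
  takes.\<close>

lemma (in prob_space) total_expectation_finite:
  fixes f :: "'a \<Rightarrow> real"
  assumes P: "finite P" and S [measurable]: "S \<in> measurable M (count_space P)"
    and f: "integrable M f"
  shows "expectation f = (\<Sum>s\<in>P. prob {\<omega> \<in> space M. S \<omega> = s} *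
    (\<integral>\<omega>. f \<omega> \<partial>uniform_measure M {\<omega> \<in> space M. S \<omega> = s}))"
proof -
  let ?A = "\<lambda>s. {\<omega> \<in> space M. S \<omega> = s}"
  have A: "?A s \<in> events" if "s \<in> P" for s
    using measurable_sets[OF S, of "{s}"] that by (simp add: vimage_def Int_def conj_commute)
  have split: "f \<omega> = (\<Sum>s\<in>P. indicator (?A s) \<omega> * f \<omega>)" if "\<omega> \<in> space M" for \<omega>
  proof -
    have "S \<omega> \<in> P"
      using measurable_space[OF S that] by simp
    then have "(\<Sum>s\<in>P. indicator (?A s) \<omega> :: real) = 1"
      using P that by (simp add: indicator_def)
    then show ?thesis
      by (simp flip: sum_distrib_right)
  qed
  have "expectation f = expectation (\<lambda>\<omega>. \<Sum>s\<in>P. indicator (?A s) \<omega> * f \<omega>)"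
    using split by (rule Bochner_Integration.integral_cong[OF refl])
  also have "\<dots> = (\<Sum>s\<in>P. expectation (\<lambda>\<omega>. indicator (?A s) \<omega> * f \<omega>))"
    using integrable_real_mult_indicator[OF A f]
    by (intro Bochner_Integration.integral_sum) (simp add: mult.commute)
  also have "\<dots> = (\<Sum>s\<in>P. prob (?A s) * (\<integral>\<omega>. f \<omega> \<partial>uniform_measure M (?A s)))"
  proof (rule sum.cong[OF refl])
    fix s assume s: "s \<in> P"
    show "expectation (\<lambda>\<omega>. indicator (?A s) \<omega> * f \<omega>)
        = prob (?A s) * (\<integral>\<omega>. f \<omega> \<partial>uniform_measure M (?A s))"
    proof (cases "prob (?A s) = 0")
      case True
      then have "AE \<omega> in M. \<omega> \<notin> ?A s"
        using prob_eq_0[OF A[OF s]] by simp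
      then have "AE \<omega> in M. indicator (?A s) \<omega> * f \<omega> = 0"
        by (rule AE_mp) (auto simp: indicator_def)
      then show ?thesis
        using True by (simp only: integral_eq_zero_AE mult_zero_left)
    next
      case False
      then show ?thesis
        using integral_uniform_measure[OF borel_measurable_integrable[OF f] A[OF s]]
        by (simp add: measure_nonneg less_le)
    qed
  qed
  finally show ?thesis .
qed

text \<open>Total expectation applied to the constant 1. On a fibre of positive probability the
  conditional measure has mass 1; on a null fibre the factor \<open>prob\<close> is 0.\<close>

lemma (in prob_space) sum_prob_finite_valued:
  assumes "finite P" "S \<in> measurable M (count_space P)"
  shows "(\<Sum>s\<in>P. prob {\<omega> \<in> space M. S \<omega> = s}) = 1"
proof -
  have "prob {\<omega> \<in> space M. S \<omega> = s} *
      (\<integral>\<omega>. 1 \<partial>uniform_measure M {\<omega> \<in> space M. S \<omega> = s}) = prob {\<omega> \<in> space M. S \<omega> = s}"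
    for s
  proof (cases "prob {\<omega> \<in> space M. S \<omega> = s} = 0")
    case False
    then have "prob_space (uniform_measure M {\<omega> \<in> space M. S \<omega> = s})"
      by (intro prob_space_uniform_measure) (auto simp: emeasure_eq_measure)
    from prob_space.prob_space[OF this] show ?thesis
      by simp
  qed simp
  then have "expectation (\<lambda>_. 1 :: real) = (\<Sum>s\<in>P. prob {\<omega> \<in> space M. S \<omega> = s})"
    by (simp only: total_expectation_finite[OF assms integrable_const])
  then show ?thesis
    by (simp add: prob_space)
qed

section \<open>Mean and variance for a random permutation\<close>

lemma
  assumes N: "N \<ge> 1" and x: "x \<in> {0..1}" and d: "dither_random M N x S Y"
  shows expectation_dither_random: "prob_space.expectation M (pulse_mean N Y) = x"
    and variance_dither_random_le:
      "prob_space.variance M (pulse_mean N Y) \<le> 1 / (real N)\<^sup>2"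
proof -
  interpret prob_space M
    using d by (simp add: dither_random_def)
  let ?P = "{\<sigma>. \<sigma> permutes {1..N}}"
  let ?p = "\<lambda>\<sigma>. prob {\<omega> \<in> space M. S \<omega> = \<sigma>}"
  let ?U = "\<lambda>\<sigma>. uniform_measure M {\<omega> \<in> space M. S \<omega> = \<sigma>}"
  have P: "finite ?P"
    by (simp add: finite_permutations)
  have S: "S \<in> measurable M (count_space ?P)"
    and fixed: "\<And>\<sigma>. ?p \<sigma> > 0 \<Longrightarrow> dither_fixed (?U \<sigma>) N x \<sigma> Y"
    using d by (auto simp: dither_random_def)
  note total = total_expectation_finite[OF P S] and sum_p = sum_prob_finite_valued[OF P S]
  \<comment> \<open>The probabilities sum to 1, so some permutation \<open>\<tau>\<close> has
    positive probability. The conditional measure there shares its space and measurable sets with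
    \<open>M\<close>, so measurability of the pulses and their values in {0, 1} carry over to
    \<open>M\<close>.\<close>
  obtain \<tau> where "?p \<tau> \<noteq> 0"
    using sum_p by (metis (no_types, lifting) sum.neutral zero_neq_one)
  then have \<tau>: "dither_fixed (?U \<tau>) N x \<tau> Y"
    by (intro fixed) (simp add: less_le measure_nonneg)
  have Y [measurable]: "Y i \<in> borel_measurable M" if "i \<in> {1..N}" for i
    using dither_fixed_pulse_measurable[OF \<tau> that] by simp
  have Y01: "Y i \<omega> \<in> {0, 1}" if "i \<in> {1..N}" "\<omega> \<in> space M" for i \<omega>
    using \<tau> that by (auto simp: dither_fixed_def)
  have meas [measurable]: "pulse_mean N Y \<in> borel_measurable M"
    unfolding pulse_mean_def[abs_def] by measurable
  have bound: "pulse_mean N Y \<omega> \<in> {0..1}" if "\<omega> \<in> space M" for \<omega>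
  proof -
    have Y_bound: "0 \<le> Y i \<omega>" "Y i \<omega> \<le> 1" if "i \<in> {1..N}" for i
      using Y01[OF that \<open>\<omega> \<in> space M\<close>] by auto
    have "(\<Sum>i=1..N. Y i \<omega>) \<le> real (card {1..N}) * 1"
      by (rule sum_bounded_above) (rule Y_bound)
    then show ?thesis
      using N sum_nonneg[of "{1..N}" "\<lambda>i. Y i \<omega>"] Y_bound by (simp add: pulse_mean_def)
  qed
  have int: "integrable M (pulse_mean N Y)"
    by (rule integrable_const_bound[where B = 1]) (use bound in \<open>auto intro!: AE_I2\<close>)
  have "\<bar>pulse_mean N Y \<omega> - x\<bar> \<le> 1" if "\<omega> \<in> space M" for \<omega>
    using bound[OF that] x by auto
  then have int2: "integrable M (\<lambda>\<omega>. (pulse_mean N Y \<omega> - x)\<^sup>2)"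
    by (intro integrable_const_bound[where B = 1]) (auto intro!: AE_I2 simp: abs_square_le_1)
  have "expectation (pulse_mean N Y) = (\<Sum>\<sigma>\<in>?P. ?p \<sigma> * x)"
    unfolding total[OF int]
  proof (rule sum.cong[OF refl])
    fix \<sigma>
    show "?p \<sigma> * (\<integral>\<omega>. pulse_mean N Y \<omega> \<partial>?U \<sigma>) = ?p \<sigma> * x"
      using expectation_dither_fixed[OF N x fixed] by (cases "?p \<sigma> = 0") (auto simp: less_le)
  qed
  then show E: "expectation (pulse_mean N Y) = x"
    using sum_p by (simp flip: sum_distrib_right)
  \<comment> \<open>The deviation is taken from \<open>x\<close>, which is also the conditional mean
    given each permutation of positive probability. Each conditional integral is therefore a
    conditional variance, and no variance between permutations is added.\<close>
  have "expectation (\<lambda>\<omega>. (pulse_mean N Y \<omega> - x)\<^sup>2) \<le> (\<Sum>\<sigma>\<in>?P. ?p \<sigma> * (1 / (real N)\<^sup>2))"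
    unfolding total[OF int2]
  proof (rule sum_mono)
    fix \<sigma>
    show "?p \<sigma> * (\<integral>\<omega>. (pulse_mean N Y \<omega> - x)\<^sup>2 \<partial>?U \<sigma>) \<le> ?p \<sigma> * (1 / (real N)\<^sup>2)"
    proof (cases "?p \<sigma> = 0")
      case False
      then have f: "dither_fixed (?U \<sigma>) N x \<sigma> Y"
        by (intro fixed) (simp add: less_le)
      show ?thesis
        using variance_dither_fixed_le[OF N x f] expectation_dither_fixed[OF N x f]
        by (intro mult_left_mono) auto
    qed simp
  qed
  then show "variance (pulse_mean N Y) \<le> 1 / (real N)\<^sup>2"
    using sum_p E by (simp flip: sum_distrib_right sum_divide_distrib)
qed

section \<open>The expected mean squared error\<close>

lemma (in prob_space) expectation_AE_bounds:
  fixes f :: "'a \<Rightarrow> real"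
  assumes ae: "AE x in M. 0 \<le> f x \<and> f x \<le> c"
  shows "0 \<le> expectation f" "expectation f \<le> c"
proof -
  show "0 \<le> expectation f"
    using ae by (intro integral_nonneg_AE) auto
  \<comment> \<open>If \<open>f\<close> is not integrable, its integral is 0 by convention; the
    upper bound then reads \<open>0 \<le> c\<close>. A constant statement that holds almost
    everywhere in a probability space is true.\<close>
  have "0 \<le> c"
  proof -
    have "AE x in M. 0 \<le> c"
      using ae by eventually_elim linarith
    then show ?thesis
      by simp
  qed
  then show "expectation f \<le> c"
    using ae by (cases "integrable M f")
      (auto intro!: integral_le_const simp: not_integrable_integral_eq elim: eventually_mono)
qed

text \<open>For almost every \<open>x\<close> the pulse mean has mean \<open>x\<close> under
  \<open>K x\<close>, so \<open>cond_mse\<close> is a variance and obeys the bound for random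
  permutations. Averaging over the law of \<open>X\<close> preserves a bound that is uniform in
  \<open>x\<close>.\<close>

lemma emse_bounds:
  fixes X :: "'a \<Rightarrow> real"
  assumes N: "N \<ge> 1" and "prob_space M" and X [measurable]: "X \<in> borel_measurable M"
    and X01: "\<And>\<omega>. \<omega> \<in> space M \<Longrightarrow> X \<omega> \<in> {0..1}"
    and ae: "AE x in distr M borel X. dither_random (K x) N x S Y"
  shows "0 \<le> emse M X K N Y" "emse M X K N Y \<le> 1 / (real N)\<^sup>2"
proof -
  interpret M: prob_space M by fact
  interpret D: prob_space "distr M borel X"
    by (rule M.prob_space_distr[OF X])
  \<comment> \<open>The moment results hold for \<open>x\<close> in the unit interval; the range of
    \<open>X\<close> supplies this almost surely under its law.\<close>
  have "AE x in distr M borel X. x \<in> {0..1}"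
    by (subst AE_distr_iff[OF X]) (use X01 in \<open>auto intro!: AE_I2\<close>)
  then have "AE x in distr M borel X. 0 \<le> cond_mse K N Y x \<and> cond_mse K N Y x \<le> 1 / (real N)\<^sup>2"
    using ae
  proof eventually_elim
    case (elim x)
    then show ?case
      using expectation_dither_random[OF N elim] variance_dither_random_le[OF N elim]
      by (simp add: cond_mse_def)
  qed
  then show "0 \<le> emse M X K N Y" "emse M X K N Y \<le> 1 / (real N)\<^sup>2"
    unfolding emse_def by (rule D.expectation_AE_bounds)+
qed

theorem mainTheorem1:
  "(\<forall>(N::nat) (x::real) (M::'a measure) (\<sigma>::nat \<Rightarrow> nat) (Y::nat \<Rightarrow> 'a \<Rightarrow> real).
      N \<ge> 1 \<and> x \<in> {0..1} \<and> dither_fixed M N x \<sigma> Y \<longrightarrow>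
      prob_space.expectation M (pulse_mean N Y) = x \<and>
      prob_space.variance M (pulse_mean N Y) \<le> 2 / (real N)\<^sup>2)
   \<and>
   (\<forall>(N::nat) (x::real) (M::'a measure) (S::'a \<Rightarrow> nat \<Rightarrow> nat) (Y::nat \<Rightarrow> 'a \<Rightarrow> real).
      N \<ge> 1 \<and> x \<in> {0..1} \<and> dither_random M N x S Y \<longrightarrow>
      prob_space.expectation M (pulse_mean N Y) = x \<and>
      prob_space.variance M (pulse_mean N Y) \<le> 2 / (real N)\<^sup>2)
   \<and>
   (\<forall>(D::real measure) (M::nat \<Rightarrow> 'a measure) (X::nat \<Rightarrow> 'a \<Rightarrow> real)
      (K::nat \<Rightarrow> real \<Rightarrow> 'a measure) (S::nat \<Rightarrow> 'a \<Rightarrow> nat \<Rightarrow> nat) (Y::nat \<Rightarrow> nat \<Rightarrow> 'a \<Rightarrow> real).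
      (\<forall>N\<ge>1.
         prob_space (M N) \<and>
         X N \<in> borel_measurable (M N) \<and>
         (\<forall>\<omega>\<in>space (M N). X N \<omega> \<in> {0..1}) \<and>
         distr (M N) borel (X N) = D \<and>
         regular_cond_prob (M N) (X N) (K N) \<and>
         (AE x in D. dither_random (K N x) N x (S N) (Y N))) \<longrightarrow>
      (\<lambda>N. emse (M N) (X N) (K N) N (Y N)) \<in> O(\<lambda>N. 1 / (real N)\<^sup>2))"
proof (intro conjI allI impI)
  fix N :: nat and x :: real and M :: "'a measure" and \<sigma> Y
  assume "N \<ge> 1 \<and> x \<in> {0..1} \<and> dither_fixed M N x \<sigma> Y"
  then have h: "N \<ge> 1" "x \<in> {0..1}" "dither_fixed M N x \<sigma> Y"
    by auto
  show "prob_space.expectation M (pulse_mean N Y) = x"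
    by (rule expectation_dither_fixed[OF h])
  have "1 / (real N)\<^sup>2 \<le> 2 / (real N)\<^sup>2"
    by (simp add: divide_right_mono)
  with variance_dither_fixed_le[OF h]
  show "prob_space.variance M (pulse_mean N Y) \<le> 2 / (real N)\<^sup>2"
    by linarith
next
  fix N :: nat and x :: real and M :: "'a measure" and S Y
  assume "N \<ge> 1 \<and> x \<in> {0..1} \<and> dither_random M N x S Y"
  then have h: "N \<ge> 1" "x \<in> {0..1}" "dither_random M N x S Y"
    by auto
  show "prob_space.expectation M (pulse_mean N Y) = x"
    by (rule expectation_dither_random[OF h])
  have "1 / (real N)\<^sup>2 \<le> 2 / (real N)\<^sup>2"
    by (simp add: divide_right_mono)
  with variance_dither_random_le[OF h]
  show "prob_space.variance M (pulse_mean N Y) \<le> 2 / (real N)\<^sup>2"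
    by linarith
next
  fix D :: "real measure" and M :: "nat \<Rightarrow> 'a measure" and X K S Y
  assume h: "\<forall>N\<ge>1.
         prob_space (M N) \<and>
         X N \<in> borel_measurable (M N) \<and>
         (\<forall>\<omega>\<in>space (M N). X N \<omega> \<in> {0..1}) \<and>
         distr (M N) borel (X N) = D \<and>
         regular_cond_prob (M N) (X N) (K N) \<and>
         (AE x in D. dither_random (K N x) N x (S N) (Y N))"
  \<comment> \<open>The estimate is uniform in the law \<open>D\<close>, so the constant 1 and the
    threshold \<open>N \<ge> 1\<close> serve as witnesses for the Landau bound.\<close>
  have "\<bar>emse (M N) (X N) (K N) N (Y N)\<bar> \<le> 1 / (real N)\<^sup>2" if N: "N \<ge> 1" for N
    using h emse_bounds[OF N, of "M N" "X N" "K N" "S N" "Y N"] N by auto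
  then show "(\<lambda>N. emse (M N) (X N) (K N) N (Y N)) \<in> O(\<lambda>N. 1 / (real N)\<^sup>2)"
    by (intro bigoI[of _ 1] eventually_at_top_linorderI[of 1]) simp
qed

end
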